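(* Consider the low-thrust dynamics $$\dot{\bm{x}} = \bm{f}(\bm{x}) + c_1 \bm{B}(\bm{x})\frac{u}{m}\hat{\bm{i}},\qquad \dot m = -\frac{c_1}{c_2}u,$$ with controls $u(t)\in[0,1]$ and $\hat{\bm{i}}(t)\in\mathbb{R}^3$, $\|\hat{\bm{i}}(t)\|=1$, a fixed initial time $t_0$, a fixed initial state $\bm{x}_0$ and a target state $\bm{x}_f$. The notions of minimum-time extremal and maximum-initial-mass extremal are those defined in the context. (i) Let $m_0>0$ and let $(\bm{x}^*(\cdot),m^*(\cdot),u^*(\cdot),\hat{\bm{i}}^*(\cdot),t_f^* )$ be an extremal of the minimum-time problem from the prescribed initial condition $\bm{x}(t_0)=\bm{x}_0$, $m(t_0)=m_0$ to the target condition $\bm{x}(t_f)=\bm{x}_f$. Then $(\bm{x}^*(\cdot),m^*(\cdot),u^*(\cdot),\hat{\bm{i}}^*(\cdot))$ is an extremal of the maximum-initial-mass problem over the fixed time interval $[t_0,t_f^*]$, with $\bm{x}(t_0)=\bm{x}_0$ and $\bm{x}(t_f^* )=\bm{x}_f$. (ii) Conversely, let $t_f^*>t_0$ and let $(\bm{x}^*(\cdot),m^*(\cdot),u^*(\cdot),\hat{\bm{i}}^*(\cdot))$ be an extremal of the maximum-initial-mass problem over the fixed time interval $[t_0,t_f^*]$ with $\bm{x}(t_0)=\bm{x}_0$ and $\bm{x}(t_f^* )=\bm{x}_f$. Then, with $m_0:=m^*(t_0)$, the tuple $(\bm{x}^*(\cdot),m^*(\cdot),u^*(\cdot),\hat{\bm{i}}^*(\cdot),t_f^*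 )$ is an extremal of the minimum-time problem with prescribed initial condition $\bm{x}(t_0)=\bm{x}_0$, $m(t_0)=m_0$ and target condition $\bm{x}(t_f)=\bm{x}_f$.
   Context: Setting. $\bm{x}$ takes values in an open set $X\subseteq\mathbb{R}^6$ (Cartesian coordinates, modified equinoctial elements, or any other coordinate representation), $\bm{f}:X\to\mathbb{R}^6$ and $\bm{B}:X\to\mathbb{R}^{6\times 3}$ are continuously differentiable, $c_1,c_2>0$ are constants (related to maximum thrust and specific impulse), and the mass $m$ is positive along trajectories. State and costate trajectories are absolutely continuous, controls are measurable, and differential equations and pointwise conditions hold for almost every $t$. Minimum-time problem (initial mass fixed): given $\bm{x}(t_0)=\bm{x}_0$ and $m(t_0)=m_0$, find controls and a final time $t_f>t_0$ with $\bm{x}(t_f)=\bm{x}_f$ minimizing $J=\int_{t_0}^{t_f}1\,dt=t_f-t_0$; the final mass is free. Its Hamiltonian is $$\mathcal{H}=\bm{\lambda}^T\left[\bm{f}(\bm{x})+c_1\bm{B}(\bm{x})\frac{u}{m}\hat{\bm{i}}\right]-\lambda_m\frac{c_1}{c_2}u+1 .$$ Maximum-initial-mass problem (final time fixed): given $\bm{x}(t_0)=\bm{x}_0$ and a fixed $t_f>t_0$, find controls with $\bm{x}(t_f)=\bm{x}_f$ minimizing $J=-m(t_0)$; the initial and final masses are free. Its Hamiltonian is $$\mathcal{H}=\bm{\lambda}^T\left[\bm{f}(\bm{x})+c_1\bm{B}(\bm{x})\frac{u}{m}\hat{\bm{i}}\right]-\lambda_m\frac{c_1}{c_2}u .$$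 Extremals. In both problems an extremal is an admissible trajectory-control pair for which there exist costates $\bm{\lambda}:[t_0,t_f]\to\mathbb{R}^6$ and $\lambda_m:[t_0,t_f]\to\mathbb{R}$ satisfying, with $\mathcal{H}$ the Hamiltonian of the respective problem: (a) the state equations (the low-thrust dynamics) and the adjoint equations $\dot{\bm{\lambda}}=-\partial\mathcal{H}/\partial\bm{x}$, $\dot\lambda_m=-\partial\mathcal{H}/\partial m$; (b) the minimum condition: at each time $(u(t),\hat{\bm{i}}(t))$ minimizes $\mathcal{H}(\bm{x}(t),m(t),\bm{\lambda}(t),\lambda_m(t),\cdot,\cdot)$ over $u\in[0,1]$, $\|\hat{\bm{i}}\|=1$; (c) nondegeneracy: $\bm{B}(\bm{x}(t))^T\bm{\lambda}(t)\neq 0$, so that the controls satisfying (b) are $\hat{\bm{i}}=-\bm{B}(\bm{x})^T\bm{\lambda}/\|\bm{B}(\bm{x})^T\bm{\lambda}\|$ and $u=1$; (d) the boundary and transversality conditions of the respective problem: - minimum time: $\bm{x}(t_0)=\bm{x}_0$, $m(t_0)=m_0$, $\bm{x}(t_f)=\bm{x}_f$, $\lambda_m(t_f)=0$, with $t_f$ part of the extremal; no condition is imposed on the terminal value of the Hamiltonian, and no normalization of the costates is imposed; - maximum initial mass: $\bm{x}(t_0)=\bm{x}_0$, $\lambda_m(t_0)=1$ (transversality for the free initial mass), $\bm{x}(t_f)=\bm{x}_f$, $\lambda_m(t_f)=0$, with $t_f$ fixed. *)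

theory Defs
  imports "HOL-Analysis.Analysis"
begin

definition continuously_differentiable_on ::
    "('a::euclidean_space \<Rightarrow> 'b::euclidean_space) \<Rightarrow> 'a set \<Rightarrow> bool" where
  "continuously_differentiable_on f X \<longleftrightarrow>
     (\<exists>f' :: 'a \<Rightarrow> 'a \<Rightarrow>\<^sub>L 'b.
        (\<forall>x\<in>X. (f has_derivative blinfun_apply (f' x)) (at x)) \<and> continuous_on X f')"

(* Absolute continuity in the epsilon-delta sense, for S an interval: a member K of D is a
   nonempty compact interval [Inf K, Sup K], and distinct members do not overlap. *)
definition absolutely_continuous_on ::
    "(real \<Rightarrow> 'a::real_normed_vector) \<Rightarrow> real set \<Rightarrow> bool" where
  "absolutely_continuous_on f S \<longleftrightarrow>
     (\<forall>\<epsilon>>0. \<exists>\<delta>>0. \<forall>D. D division_of \<Union>D \<and> \<Union>D \<subseteq> S \<and> (\<Sum>K\<in>D. Sup K - Inf K) < \<delta>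
        \<longrightarrow> (\<Sum>K\<in>D. norm (f (Sup K) - f (Inf K))) < \<epsilon>)"

(* B x is a matrix with 6 rows and 3 columns. *)
definition state_rate ::
    "real \<Rightarrow> (real^6 \<Rightarrow> real^6) \<Rightarrow> (real^6 \<Rightarrow> real^3^6) \<Rightarrow>
     real^6 \<Rightarrow> real \<Rightarrow> real \<Rightarrow> real^3 \<Rightarrow> real^6" where
  "state_rate c1 f B x m u i = f x + (c1 * (u / m)) *\<^sub>R (B x *v i)"

definition mass_rate :: "real \<Rightarrow> real \<Rightarrow> real \<Rightarrow> real" where
  "mass_rate c1 c2 u = - (c1 / c2) * u"

(* Arguments: state x, mass m, costates lam and lamm, throttle u, thrust direction i. *)
type_synonym hamiltonian =
  "real^6 \<Rightarrow> real \<Rightarrow> real^6 \<Rightarrow> real \<Rightarrow> real \<Rightarrow> real^3 \<Rightarrow> real"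

definition min_time_hamiltonian ::
    "real \<Rightarrow> real \<Rightarrow> (real^6 \<Rightarrow> real^6) \<Rightarrow> (real^6 \<Rightarrow> real^3^6) \<Rightarrow> hamiltonian" where
  "min_time_hamiltonian c1 c2 f B x m lam lamm u i =
     lam \<bullet> (f x + (c1 * (u / m)) *\<^sub>R (B x *v i)) - lamm * (c1 / c2) * u + 1"

definition max_mass_hamiltonian ::
    "real \<Rightarrow> real \<Rightarrow> (real^6 \<Rightarrow> real^6) \<Rightarrow> (real^6 \<Rightarrow> real^3^6) \<Rightarrow> hamiltonian" where
  "max_mass_hamiltonian c1 c2 f B x m lam lamm u i =
     lam \<bullet> (f x + (c1 * (u / m)) *\<^sub>R (B x *v i)) - lamm * (c1 / c2) * u"

definition admissible_control :: "real \<Rightarrow> real^3 \<Rightarrow> bool" where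
  "admissible_control u i \<longleftrightarrow> u \<in> {0..1} \<and> norm i = 1"

definition admissible_trajectory ::
    "real \<Rightarrow> real \<Rightarrow> (real^6) set \<Rightarrow> (real^6 \<Rightarrow> real^6) \<Rightarrow> (real^6 \<Rightarrow> real^3^6) \<Rightarrow>
     real \<Rightarrow> real \<Rightarrow> (real \<Rightarrow> real^6) \<Rightarrow> (real \<Rightarrow> real) \<Rightarrow> (real \<Rightarrow> real) \<Rightarrow> (real \<Rightarrow> real^3) \<Rightarrow> bool" where
  "admissible_trajectory c1 c2 X f B t0 tf x m u i \<longleftrightarrow>
     absolutely_continuous_on x {t0..tf} \<and> absolutely_continuous_on m {t0..tf} \<and>
     u \<in> borel_measurable (lebesgue_on {t0..tf}) \<and> i \<in> borel_measurable (lebesgue_on {t0..tf}) \<and>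
     (\<forall>t\<in>{t0..tf}. x t \<in> X \<and> m t > 0) \<and>
     (AE t in lebesgue_on {t0..tf}.
        admissible_control (u t) (i t) \<and>
        (x has_vector_derivative state_rate c1 f B (x t) (m t) (u t) (i t)) (at t within {t0..tf}) \<and>
        (m has_real_derivative mass_rate c1 c2 (u t)) (at t within {t0..tf}))"

definition adjoint_equations ::
    "hamiltonian \<Rightarrow> real \<Rightarrow> real \<Rightarrow> (real \<Rightarrow> real^6) \<Rightarrow> (real \<Rightarrow> real) \<Rightarrow> (real \<Rightarrow> real) \<Rightarrow>
     (real \<Rightarrow> real^3) \<Rightarrow> (real \<Rightarrow> real^6) \<Rightarrow> (real \<Rightarrow> real) \<Rightarrow> bool" where
  "adjoint_equations H t0 tf x m u i lam lamm \<longleftrightarrow>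
     (AE t in lebesgue_on {t0..tf}. \<exists>Hx Hm.
        (GDERIV (\<lambda>y. H y (m t) (lam t) (lamm t) (u t) (i t)) (x t) :> Hx) \<and>
        ((\<lambda>\<mu>. H (x t) \<mu> (lam t) (lamm t) (u t) (i t)) has_real_derivative Hm) (at (m t)) \<and>
        (lam has_vector_derivative - Hx) (at t within {t0..tf}) \<and>
        (lamm has_real_derivative - Hm) (at t within {t0..tf}))"

definition minimum_condition ::
    "hamiltonian \<Rightarrow> real \<Rightarrow> real \<Rightarrow> (real \<Rightarrow> real^6) \<Rightarrow> (real \<Rightarrow> real) \<Rightarrow> (real \<Rightarrow> real) \<Rightarrow>
     (real \<Rightarrow> real^3) \<Rightarrow> (real \<Rightarrow> real^6) \<Rightarrow> (real \<Rightarrow> real) \<Rightarrow> bool" where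
  "minimum_condition H t0 tf x m u i lam lamm \<longleftrightarrow>
     (AE t in lebesgue_on {t0..tf}.
        is_arg_min (\<lambda>(v, w). H (x t) (m t) (lam t) (lamm t) v w)
          (\<lambda>(v, w). admissible_control v w) (u t, i t))"

(* In both problems lamm turns out to be nonnegative, so together with the minimum condition this
   forces u = 1 and i = - B^T lam / |B^T lam| almost everywhere; that consequence is not assumed. *)
definition nondegenerate ::
    "(real^6 \<Rightarrow> real^3^6) \<Rightarrow> real \<Rightarrow> real \<Rightarrow> (real \<Rightarrow> real^6) \<Rightarrow> (real \<Rightarrow> real^6) \<Rightarrow> bool" where
  "nondegenerate B t0 tf x lam \<longleftrightarrow>
     (AE t in lebesgue_on {t0..tf}. transpose (B (x t)) *v lam t \<noteq> 0)"

definition costates_for ::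
    "hamiltonian \<Rightarrow> (real^6 \<Rightarrow> real^3^6) \<Rightarrow> real \<Rightarrow> real \<Rightarrow> (real \<Rightarrow> real^6) \<Rightarrow> (real \<Rightarrow> real) \<Rightarrow>
     (real \<Rightarrow> real) \<Rightarrow> (real \<Rightarrow> real^3) \<Rightarrow> (real \<Rightarrow> real^6) \<Rightarrow> (real \<Rightarrow> real) \<Rightarrow> bool" where
  "costates_for H B t0 tf x m u i lam lamm \<longleftrightarrow>
     absolutely_continuous_on lam {t0..tf} \<and> absolutely_continuous_on lamm {t0..tf} \<and>
     adjoint_equations H t0 tf x m u i lam lamm \<and>
     minimum_condition H t0 tf x m u i lam lamm \<and>
     nondegenerate B t0 tf x lam"

definition min_time_extremal ::
    "real \<Rightarrow> real \<Rightarrow> (real^6) set \<Rightarrow> (real^6 \<Rightarrow> real^6) \<Rightarrow> (real^6 \<Rightarrow> real^3^6) \<Rightarrow>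
     real \<Rightarrow> real^6 \<Rightarrow> real \<Rightarrow> real^6 \<Rightarrow>
     (real \<Rightarrow> real^6) \<Rightarrow> (real \<Rightarrow> real) \<Rightarrow> (real \<Rightarrow> real) \<Rightarrow> (real \<Rightarrow> real^3) \<Rightarrow> real \<Rightarrow> bool" where
  "min_time_extremal c1 c2 X f B t0 x0 m0 xf x m u i tf \<longleftrightarrow>
     t0 < tf \<and> admissible_trajectory c1 c2 X f B t0 tf x m u i \<and>
     x t0 = x0 \<and> m t0 = m0 \<and> x tf = xf \<and>
     (\<exists>lam lamm. costates_for (min_time_hamiltonian c1 c2 f B) B t0 tf x m u i lam lamm \<and>
        lamm tf = 0)"

definition max_initial_mass_extremal ::
    "real \<Rightarrow> real \<Rightarrow> (real^6) set \<Rightarrow> (real^6 \<Rightarrow> real^6) \<Rightarrow> (real^6 \<Rightarrow> real^3^6) \<Rightarrow>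
     real \<Rightarrow> real \<Rightarrow> real^6 \<Rightarrow> real^6 \<Rightarrow>
     (real \<Rightarrow> real^6) \<Rightarrow> (real \<Rightarrow> real) \<Rightarrow> (real \<Rightarrow> real) \<Rightarrow> (real \<Rightarrow> real^3) \<Rightarrow> bool" where
  "max_initial_mass_extremal c1 c2 X f B t0 tf x0 xf x m u i \<longleftrightarrow>
     t0 < tf \<and> admissible_trajectory c1 c2 X f B t0 tf x m u i \<and>
     x t0 = x0 \<and> x tf = xf \<and>
     (\<exists>lam lamm. costates_for (max_mass_hamiltonian c1 c2 f B) B t0 tf x m u i lam lamm \<and>
        lamm t0 = 1 \<and> lamm tf = 0)"

end

(* The two Hamiltonians differ by a constant, so they have the same adjoint equations and minimum
   condition, and both are invariant under scaling the costates by a positive factor. Everything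
   reduces to lamm t0 > 0: then a minimum-time costate can be normalised to lamm t0 = 1. By the
   minimum condition the thrust is opposite to the primer vector p = B^T lam whenever u > 0, so
   lamm' = - c1 u |p| / m^2 <= 0 almost everywhere. As lamm is absolutely continuous with
   lamm tf = 0, it is nonnegative; this forces u = 1, so lamm' < 0 almost everywhere. *)

theory Submission
  imports Defs
begin

section \<open>Absolutely continuous functions\<close>

text \<open>An explicit exceptional null set can be covered by an open set of small measure and
  reused unchanged on every subinterval.\<close>

lemma AE_lebesgue_on_Icc:
  fixes a b :: real
  shows "(AE t in lebesgue_on {a..b}. P t) \<longleftrightarrow>
    (\<exists>N. negligible N \<and> (\<forall>t\<in>{a..b}. t \<notin> N \<longrightarrow> P t))"
  by (simp add: AE_restrict_space_iff eventually_ae_filter_negligible subset_iff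
      Ball_def Bex_def imp_conjL not_imp) (metis (no_types))

lemma absolutely_continuous_onE:
  assumes "absolutely_continuous_on f S" "e > 0"
  obtains d where "d > 0" "\<And>D. D division_of \<Union>D \<Longrightarrow> \<Union>D \<subseteq> S \<Longrightarrow>
      (\<Sum>K\<in>D. Sup K - Inf K) < d \<Longrightarrow> (\<Sum>K\<in>D. norm (f (Sup K) - f (Inf K))) < e"
proof -
  from assms(1)[unfolded absolutely_continuous_on_def, rule_format, OF assms(2)]
  obtain d where "d > 0 \<and> (\<forall>D. D division_of \<Union>D \<and> \<Union>D \<subseteq> S \<and> (\<Sum>K\<in>D. Sup K - Inf K) < d \<longrightarrow>
      (\<Sum>K\<in>D. norm (f (Sup K) - f (Inf K))) < e)" ..
  then show thesis
    by (intro that[of d]) simp_all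
qed

lemma absolutely_continuous_on_subset:
  "absolutely_continuous_on f S \<Longrightarrow> T \<subseteq> S \<Longrightarrow> absolutely_continuous_on f T"
  unfolding absolutely_continuous_on_def[of f T]
proof (intro allI impI)
  fix e :: real assume f: "absolutely_continuous_on f S" and "T \<subseteq> S" "e > 0"
  obtain d where "d > 0" and d: "\<And>D. D division_of \<Union>D \<Longrightarrow> \<Union>D \<subseteq> S \<Longrightarrow>
      (\<Sum>K\<in>D. Sup K - Inf K) < d \<Longrightarrow> (\<Sum>K\<in>D. norm (f (Sup K) - f (Inf K))) < e"
    by (rule absolutely_continuous_onE[OF f \<open>e > 0\<close>]) (rule that)
  show "\<exists>d>0. \<forall>D. D division_of \<Union>D \<and> \<Union>D \<subseteq> T \<and> (\<Sum>K\<in>D. Sup K - Inf K) < d \<longrightarrow>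
      (\<Sum>K\<in>D. norm (f (Sup K) - f (Inf K))) < e"
    using \<open>d > 0\<close> d \<open>T \<subseteq> S\<close> by (intro exI[of _ d]) (simp add: order_trans[of _ T S])
qed

lemma absolutely_continuous_on_scaleR:
  assumes "absolutely_continuous_on f S"
  shows "absolutely_continuous_on (\<lambda>t. c *\<^sub>R f t) S"
  unfolding absolutely_continuous_on_def
proof (intro allI impI)
  fix e :: real assume "e > 0"
  \<comment> \<open>The summand 1 keeps the divisor positive when \<open>c = 0\<close> and makes the
    final estimate strict.\<close>
  define e' where "e' = e / (\<bar>c\<bar> + 1)"
  have "e' > 0" using \<open>e > 0\<close> by (simp add: e'_def add_nonneg_pos)
  obtain d where "d > 0" and d: "\<And>D. D division_of \<Union>D \<Longrightarrow> \<Union>D \<subseteq> S \<Longrightarrow>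
      (\<Sum>K\<in>D. Sup K - Inf K) < d \<Longrightarrow> (\<Sum>K\<in>D. norm (f (Sup K) - f (Inf K))) < e'"
    by (rule absolutely_continuous_onE[OF assms \<open>e' > 0\<close>]) (rule that)
  have "(\<Sum>K\<in>D. norm (c *\<^sub>R f (Sup K) - c *\<^sub>R f (Inf K))) < e"
    if D: "D division_of \<Union>D" "\<Union>D \<subseteq> S" "(\<Sum>K\<in>D. Sup K - Inf K) < d" for D
  proof -
    have "(\<Sum>K\<in>D. norm (c *\<^sub>R f (Sup K) - c *\<^sub>R f (Inf K)))
        = \<bar>c\<bar> * (\<Sum>K\<in>D. norm (f (Sup K) - f (Inf K)))"
      by (simp add: sum_distrib_left flip: scaleR_diff_right)
    also have "\<dots> \<le> \<bar>c\<bar> * e'"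
      using d[OF D] by (intro mult_left_mono) auto
    also have "\<dots> < (\<bar>c\<bar> + 1) * e'"
      using \<open>e' > 0\<close> by simp
    also have "\<dots> = e"
      by (simp add: e'_def add_nonneg_eq_0_iff)
    finally show ?thesis .
  qed
  with \<open>d > 0\<close> show "\<exists>d>0. \<forall>D. D division_of \<Union>D \<and> \<Union>D \<subseteq> S \<and> (\<Sum>K\<in>D. Sup K - Inf K) < d \<longrightarrow>
      (\<Sum>K\<in>D. norm (c *\<^sub>R f (Sup K) - c *\<^sub>R f (Inf K))) < e"
    by (intro exI[of _ d]) simp
qed

text \<open>Straddle estimate: because \<open>t\<close> lies between \<open>u\<close> and
  \<open>v\<close>, the linearisation errors on the two sides add up to exactly
  \<open>e * (v - u)\<close>, while the derivative terms on both sides are nonpositive.\<close>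

lemma nonpos_derivative_increment:
  fixes g :: "real \<Rightarrow> real"
  assumes g: "(g has_real_derivative D) (at t within S)" and "D \<le> 0" "e > 0"
  obtains r where "r > 0"
    "\<And>u v. u \<in> S \<Longrightarrow> v \<in> S \<Longrightarrow> u \<in> ball t r \<Longrightarrow> v \<in> ball t r \<Longrightarrow> u \<le> t \<Longrightarrow> t \<le> v \<Longrightarrow>
       g v - g u \<le> e * (v - u)"
proof -
  have "(g has_derivative (\<lambda>h. D * h)) (at t within S)"
    using g by (simp add: has_field_derivative_def)
  with \<open>e > 0\<close> obtain r where "r > 0"
    and r: "\<And>s. s \<in> S \<Longrightarrow> \<bar>s - t\<bar> < r \<Longrightarrow> \<bar>g s - g t - D * (s - t)\<bar> \<le> e * \<bar>s - t\<bar>"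
    unfolding has_derivative_within_alt by (metis real_norm_def)
  show thesis
  proof
    fix u v
    assume uv: "u \<in> S" "v \<in> S" "u \<in> ball t r" "v \<in> ball t r" "u \<le> t" "t \<le> v"
    have "\<bar>u - t\<bar> < r" "\<bar>v - t\<bar> < r"
      using uv by (auto simp: dist_real_def)
    with r[of u] r[of v] uv have "g v - g t \<le> D * (v - t) + e * (v - t)"
      "g t - g u \<le> D * (t - u) + e * (t - u)"
      by (auto simp: algebra_simps abs_le_iff)
    moreover have "D * (v - t) \<le> 0" "D * (t - u) \<le> 0"
      using uv \<open>D \<le> 0\<close> by (auto intro: mult_nonpos_nonneg)
    ultimately show "g v - g u \<le> e * (v - u)"
      by (simp add: algebra_simps)
  qed (fact \<open>r > 0\<close>)
qed

text \<open>
  Intervals of a fine tagged division that are tagged outside the exceptional null set \<open>N\<close> satisfy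
  the increment bound; those tagged in \<open>N\<close> lie in an open set of small measure, where absolute
  continuity applies.
\<close>

lemma absolutely_continuous_on_nonincreasing:
  fixes g :: "real \<Rightarrow> real"
  assumes "a \<le> b" and ac: "absolutely_continuous_on g {a..b}"
    and der: "AE t in lebesgue_on {a..b}. \<exists>D\<le>0. (g has_real_derivative D) (at t within {a..b})"
  shows "g b \<le> g a"
proof -
  obtain N where N: "negligible N"
    and der: "\<And>t. t \<in> {a..b} \<Longrightarrow> t \<notin> N \<Longrightarrow>
      \<exists>D\<le>0. (g has_real_derivative D) (at t within {a..b})"
    using der unfolding AE_lebesgue_on_Icc by blast
  \<comment> \<open>The term \<open>e * (b - a)\<close> pays for the intervals tagged outside
    \<open>N\<close>, the term \<open>e\<close> for those tagged in \<open>N\<close>.\<close>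
  have bound: "g b - g a \<le> e * (b - a) + e" if "e > 0" for e
  proof -
    obtain d where "d > 0" and d: "\<And>D. D division_of \<Union>D \<Longrightarrow> \<Union>D \<subseteq> {a..b} \<Longrightarrow>
        (\<Sum>K\<in>D. Sup K - Inf K) < d \<Longrightarrow> (\<Sum>K\<in>D. norm (g (Sup K) - g (Inf K))) < e"
      by (rule absolutely_continuous_onE[OF ac \<open>e > 0\<close>]) (rule that)
    \<comment> \<open>Outer regularity bounds only the measure of \<open>U - N\<close>; restoring
      the null set \<open>N\<close> does not change it.\<close>
    obtain U where U: "open U" "N \<subseteq> U" "U \<in> lmeasurable" "measure lebesgue U < d"
    proof -
      obtain U where U: "open U" "N \<subseteq> U" "U - N \<in> lmeasurable" "emeasure lebesgue (U - N) < ennreal d"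
        using sets_lebesgue_outer_open[OF negligible_imp_sets[OF N] \<open>d > 0\<close>] .
      have eq: "U - N \<union> N = U"
        using U(2) by blast
      have "U - N \<union> N \<in> lmeasurable"
        by (rule fmeasurable.Un[OF U(3) negligible_imp_measurable[OF N]])
      then have "U \<in> lmeasurable"
        unfolding eq .
      moreover have "measure lebesgue (U - N \<union> N) = measure lebesgue (U - N)"
        using U(3) N by (intro measure_Un_null_set fmeasurableD) (simp_all add: negligible_iff_null_sets)
      then have "measure lebesgue U = measure lebesgue (U - N)"
        unfolding eq .
      moreover have "measure lebesgue (U - N) < d"
        using U(3,4) by (simp add: emeasure_eq_measure2 ennreal_less_iff)
      ultimately show thesis using that[of U] U(1,2) by simp
    qed
    \<comment> \<open>Both requirements are stated for every real \<open>t\<close>, so that the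
      chosen radii form a gauge. Outside \<open>N\<close> and \<open>{a..b}\<close> any positive
      radius will do.\<close>
    have "\<exists>r>0. (t \<in> N \<longrightarrow> ball t r \<subseteq> U) \<and> (t \<in> {a..b} - N \<longrightarrow>
        (\<forall>u v. u \<in> {a..b} \<longrightarrow> v \<in> {a..b} \<longrightarrow> u \<in> ball t r \<longrightarrow> v \<in> ball t r \<longrightarrow> u \<le> t \<longrightarrow> t \<le> v \<longrightarrow>
          g v - g u \<le> e * (v - u)))" for t
    proof (cases "t \<in> N")
      case True
      then show ?thesis
        using U open_contains_ball[of U] by auto
    next
      case False
      show ?thesis
      proof (cases "t \<in> {a..b}")
        case True
        with False der obtain D where D: "D \<le> 0" "(g has_real_derivative D) (at t within {a..b})"
          by blast
        show ?thesis
          using nonpos_derivative_increment[OF D(2,1) \<open>e > 0\<close>] False by metis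
      qed (use False in \<open>auto intro: exI[of _ 1]\<close>)
    qed
    then obtain r where r: "\<And>t. r t > 0" "\<And>t. t \<in> N \<Longrightarrow> ball t (r t) \<subseteq> U"
      and inc: "\<And>t u v. t \<in> {a..b} \<Longrightarrow> t \<notin> N \<Longrightarrow> u \<in> {a..b} \<Longrightarrow> v \<in> {a..b} \<Longrightarrow> u \<in> ball t (r t) \<Longrightarrow>
          v \<in> ball t (r t) \<Longrightarrow> u \<le> t \<Longrightarrow> t \<le> v \<Longrightarrow> g v - g u \<le> e * (v - u)"
      unfolding Diff_iff by metis
    have "gauge (\<lambda>t. ball t (r t))"
      using r(1) by (auto simp: gauge_def)
    then obtain p where p: "p tagged_division_of {a..b}" "(\<lambda>t. ball t (r t)) fine p"
      by (rule fine_division_exists_real)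
    have fin: "finite p"
      using p(1) by blast
    have interval: "\<exists>u v. K = {u..v} \<and> u \<le> t \<and> t \<le> v" "K \<subseteq> {a..b}" "K \<subseteq> ball t (r t)" "t \<in> K"
      if "(t, K) \<in> p" for t K
    proof -
      show *: "t \<in> K" "K \<subseteq> {a..b}" "K \<subseteq> ball t (r t)"
        using tagged_division_ofD(2,3)[OF p(1) that] fineD[OF p(2) that] by auto
      obtain u v where "K = {u..v}"
        using tagged_division_ofD(4)[OF p(1) \<open>(t, K) \<in> p\<close>] by auto
      with * show "\<exists>u v. K = {u..v} \<and> u \<le> t \<and> t \<le> v"
        by auto
    qed
    define P where "P = {q \<in> p. fst q \<in> N}"
    define D where "D = snd ` P"
    have Psub: "P \<subseteq> p"
      by (auto simp: P_def)
    have Ptag: "P tagged_partial_division_of {a..b}"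
      using tagged_partial_division_subset[OF _ Psub] p(1) by (auto simp: tagged_division_of_def)
    have Ddiv: "D division_of \<Union>D"
      using partial_division_of_tagged_division[OF Ptag] by (simp add: D_def)
    have D_Icc: "\<Union>D \<subseteq> {a..b}"
      using interval(2) by (force simp: D_def P_def)
    \<comment> \<open>The intervals tagged in \<open>N\<close> do not overlap and lie inside
      \<open>U\<close>, so their total length is below the threshold \<open>d\<close> of absolute
      continuity.\<close>
    have "(\<Sum>K\<in>D. Sup K - Inf K) = (\<Sum>K\<in>D. measure lebesgue K)"
    proof (rule sum.cong)
      fix K assume "K \<in> D"
      then obtain t where "(t, K) \<in> p"
        by (auto simp: D_def P_def)
      then obtain u v where "K = {u..v}" "u \<le> v"
        using interval(1) by (metis order_trans)
      then show "Sup K - Inf K = measure lebesgue K"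
        by simp
    qed simp
    also have "\<dots> = measure lebesgue (\<Union>D)"
      by (rule content_division[OF Ddiv])
    also have "\<dots> \<le> measure lebesgue U"
    proof (rule measure_mono_fmeasurable)
      show "\<Union>D \<subseteq> U"
        using interval(3) r(2) by (fastforce simp: D_def P_def)
      show "\<Union>D \<in> sets lebesgue"
        using lmeasurable_division[OF Ddiv] by blast
    qed (use U in simp)
    also have "\<dots> < d"
      by (fact U)
    finally have small: "(\<Sum>K\<in>D. norm (g (Sup K) - g (Inf K))) < e"
      using d Ddiv D_Icc by blast
    \<comment> \<open>Passing from a sum over tagged pairs to a sum over intervals is legitimate for
      a function vanishing on intervals with empty interior. The empty set gets the value 0 by hand,
      since its \<open>Sup\<close> and \<open>Inf\<close> are meaningless; tagged intervals are
      nonempty, so there \<open>v\<close> is the actual increment.\<close>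
    define v where "v K = (if K = {} then 0 else norm (g (Sup K) - g (Inf K)))" for K
    have v: "v K = norm (g (Sup K) - g (Inf K))" if "(t, K) \<in> P" for t K
      using interval(4)[of t K] that by (auto simp: v_def P_def)
    have "(\<Sum>(t,K)\<in>P. norm (g (Sup K) - g (Inf K))) = (\<Sum>(t,K)\<in>P. v K)"
      using v by (intro sum.cong) auto
    also have "\<dots> = (\<Sum>K\<in>D. v K)"
      unfolding D_def
    proof (rule sum.over_tagged_division_lemma[OF tagged_partial_division_of_Union_self[OF Ptag]])
      fix s t :: real assume "box s t = {}"
      then show "v (cbox s t) = 0"
        by (cases "s = t") (auto simp: v_def)
    qed
    also have "\<dots> = (\<Sum>K\<in>D. norm (g (Sup K) - g (Inf K)))"
      using v by (intro sum.cong) (auto simp: D_def)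
    finally have "(\<Sum>(t,K)\<in>P. norm (g (Sup K) - g (Inf K))) = (\<Sum>K\<in>D. norm (g (Sup K) - g (Inf K)))" .
    moreover have "(\<Sum>(t,K)\<in>P. g (Sup K) - g (Inf K)) \<le> (\<Sum>(t,K)\<in>P. norm (g (Sup K) - g (Inf K)))"
      by (rule sum_mono) auto
    ultimately have inN: "(\<Sum>(t,K)\<in>P. g (Sup K) - g (Inf K)) \<le> e"
      using small by simp
    have "(\<Sum>(t,K)\<in>p - P. g (Sup K) - g (Inf K)) \<le> (\<Sum>(t,K)\<in>p - P. e * (Sup K - Inf K))"
    proof (rule sum_mono, clarify)
      fix t K assume tK: "(t, K) \<in> p" "(t, K) \<notin> P"
      obtain u v where K: "K = {u..v}" "u \<le> t" "t \<le> v"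
        using interval(1)[OF tK(1)] by blast
      then have "u \<in> K" "v \<in> K" by auto
      then show "g (Sup K) - g (Inf K) \<le> e * (Sup K - Inf K)"
        using inc[of t u v] interval(2,3,4)[OF tK(1)] tK K by (auto simp: P_def subset_iff)
    qed
    \<comment> \<open>The terms added back are nonnegative, and over the full division the lengths
      telescope to \<open>b - a\<close>.\<close>
    also have "\<dots> \<le> (\<Sum>(t,K)\<in>p. e * (Sup K - Inf K))"
    proof (rule sum_mono2[OF fin])
      fix q assume "q \<in> p - (p - P)"
      then obtain t K where tK: "q = (t, K)" "(t, K) \<in> p"
        by (cases q) auto
      obtain u v where "K = {u..v}" "u \<le> t" "t \<le> v"
        using interval(1)[OF tK(2)] by blast
      then show "0 \<le> (case q of (t, K) \<Rightarrow> e * (Sup K - Inf K))"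
        using tK \<open>e > 0\<close> by simp
    qed auto
    also have "\<dots> = e * (\<Sum>(t,K)\<in>p. Sup K - Inf K)"
      by (simp add: sum_distrib_left case_prod_beta)
    also have "(\<Sum>(t,K)\<in>p. Sup K - Inf K) = b - a"
      using additive_tagged_division_1[OF \<open>a \<le> b\<close> p(1), of "\<lambda>x. x"] by simp
    finally have outN: "(\<Sum>(t,K)\<in>p - P. g (Sup K) - g (Inf K)) \<le> e * (b - a)" .
    have "g b - g a = (\<Sum>(t,K)\<in>p. g (Sup K) - g (Inf K))"
      using additive_tagged_division_1[OF \<open>a \<le> b\<close> p(1)] by metis
    also have "\<dots> = (\<Sum>(t,K)\<in>p - P. g (Sup K) - g (Inf K)) + (\<Sum>(t,K)\<in>P. g (Sup K) - g (Inf K))"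
      by (rule sum.subset_diff[OF Psub fin])
    finally show ?thesis
      using inN outN by simp
  qed
  have "g b - g a \<le> 0"
  proof (rule field_le_epsilon)
    fix e :: real assume "e > 0"
    \<comment> \<open>With this choice the two errors \<open>e' * (b - a)\<close> and
      \<open>e'\<close> sum to exactly \<open>e\<close>; the summand 1 covers the case
      \<open>a = b\<close>.\<close>
    define e' where "e' = e / (b - a + 1)"
    have "e' > 0" "e' * (b - a + 1) = e"
      using \<open>a \<le> b\<close> \<open>e > 0\<close> by (simp_all add: e'_def)
    with bound[of e'] show "g b - g a \<le> 0 + e"
      by (simp add: distrib_left)
  qed
  then show ?thesis by simp
qed

text \<open>The endpoint inequality applies on each subinterval \<open>{s..t}\<close>, because
  absolute continuity, the exceptional null set and derivatives within the interval all restrict to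
  it.\<close>

lemma absolutely_continuous_on_antimono_on:
  fixes g :: "real \<Rightarrow> real"
  assumes ac: "absolutely_continuous_on g {a..b}"
    and der: "AE t in lebesgue_on {a..b}. \<exists>D\<le>0. (g has_real_derivative D) (at t within {a..b})"
  shows "antimono_on {a..b} g"
proof (rule monotone_onI)
  fix s t assume st: "s \<in> {a..b}" "t \<in> {a..b}" "s \<le> t"
  then have sub: "{s..t} \<subseteq> {a..b}" by auto
  from der obtain N where "negligible N"
    and "\<And>t. t \<in> {a..b} \<Longrightarrow> t \<notin> N \<Longrightarrow> \<exists>D\<le>0. (g has_real_derivative D) (at t within {a..b})"
    unfolding AE_lebesgue_on_Icc by blast
  then have "AE r in lebesgue_on {s..t}. \<exists>D\<le>0. (g has_real_derivative D) (at r within {s..t})"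
    unfolding AE_lebesgue_on_Icc using sub by (meson DERIV_subset subsetD)
  then show "g t \<le> g s"
    using absolutely_continuous_on_nonincreasing absolutely_continuous_on_subset[OF ac sub] st by blast
qed

text \<open>Without a strict drop, monotonicity would make \<open>g\<close> constant, with
  derivative 0 throughout. An interval of positive length is not null, so it contains a point where
  the derivative is negative, a contradiction.\<close>

lemma absolutely_continuous_on_decreasing:
  fixes g :: "real \<Rightarrow> real"
  assumes "a < b" and ac: "absolutely_continuous_on g {a..b}"
    and der: "AE t in lebesgue_on {a..b}. \<exists>D<0. (g has_real_derivative D) (at t within {a..b})"
  shows "g b < g a"
proof (rule ccontr)
  assume "\<not> g b < g a"
  have "antimono_on {a..b} g"
    by (rule absolutely_continuous_on_antimono_on[OF ac])
      (use der in \<open>eventually_elim, auto intro: less_imp_le\<close>)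
  then have "g t \<le> g a" "g b \<le> g t" if "t \<in> {a..b}" for t
    using that \<open>a < b\<close> monotone_onD[of "{a..b}" "(\<le>)" "(\<ge>)" g] by auto
  with \<open>\<not> g b < g a\<close> have const: "g t = g a" if "t \<in> {a..b}" for t
    using that by fastforce
  obtain N where "negligible N"
    and N: "\<And>t. t \<in> {a..b} \<Longrightarrow> t \<notin> N \<Longrightarrow> \<exists>D<0. (g has_real_derivative D) (at t within {a..b})"
    using der unfolding AE_lebesgue_on_Icc by blast
  moreover have "\<not> negligible {a..b}"
    using \<open>a < b\<close> negligible_interval(1)[of a b] by simp
  ultimately obtain t where t: "t \<in> {a..b}" "t \<notin> N"
    using negligible_subset by blast
  then obtain D where "D < 0" and D: "(g has_real_derivative D) (at t within {a..b})"
    using N by blast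
  have "(g has_real_derivative 0) (at t within {a..b})"
    by (rule has_field_derivative_transform_within[OF DERIV_const[of "g a"] zero_less_one t(1)])
      (rule const[symmetric])
  with D have "D = 0"
    \<comment> \<open>The point \<open>t\<close> may be an endpoint, so uniqueness is needed for
      derivatives within the nondegenerate closed interval.\<close>
    using vector_derivative_unique_within_closed_interval[of a b t g D 0] \<open>a < b\<close> t(1)
    unfolding has_real_derivative_iff_has_vector_derivative box_real by blast
  with \<open>D < 0\<close> show False
    by simp
qed

section \<open>Costates\<close>

lemma min_time_hamiltonian_eq:
  "min_time_hamiltonian c1 c2 f B x m lam lamm u i = max_mass_hamiltonian c1 c2 f B x m lam lamm u i + 1"
  by (simp add: min_time_hamiltonian_def max_mass_hamiltonian_def)

lemma GDERIV_add_const_iff: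
  "(GDERIV (\<lambda>y. h y + (c::real)) x :> D) \<longleftrightarrow> (GDERIV h x :> D)"
  unfolding gderiv_def
proof
  assume "((\<lambda>y. h y + c) has_derivative (\<lambda>h. h \<bullet> D)) (at x)"
  from has_derivative_diff[OF this has_derivative_const[of c]]
  show "(h has_derivative (\<lambda>h. h \<bullet> D)) (at x)" by simp
next
  assume "(h has_derivative (\<lambda>h. h \<bullet> D)) (at x)"
  from has_derivative_add[OF this has_derivative_const[of c]]
  show "((\<lambda>y. h y + c) has_derivative (\<lambda>h. h \<bullet> D)) (at x)" by simp
qed

lemma DERIV_add_const_iff:
  fixes h :: "real \<Rightarrow> real"
  shows "((\<lambda>y. h y + c) has_real_derivative D) (at x) \<longleftrightarrow> (h has_real_derivative D) (at x)"
  \<comment> \<open>On the real line the gradient is the ordinary derivative.\<close>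
  using GDERIV_add_const_iff[of h c x D] by simp

text \<open>The constant 1 drops out of the gradient, of the mass derivative and of every comparison
  between Hamiltonian values; the other clauses do not involve the Hamiltonian.\<close>

lemma costates_for_min_time_iff:
  "costates_for (min_time_hamiltonian c1 c2 f B) = costates_for (max_mass_hamiltonian c1 c2 f B)"
  unfolding fun_eq_iff costates_for_def adjoint_equations_def minimum_condition_def is_arg_min_def
    case_prod_beta min_time_hamiltonian_eq GDERIV_add_const_iff DERIV_add_const_iff add_less_cancel_right
  by (intro allI refl)

lemma max_mass_hamiltonian_scale:
  "max_mass_hamiltonian c1 c2 f B x m (k *\<^sub>R lam) (k * lamm) u i
    = k * max_mass_hamiltonian c1 c2 f B x m lam lamm u i"
  by (simp add: max_mass_hamiltonian_def algebra_simps)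

text \<open>The Hamiltonian without the constant is homogeneous of degree one in the costates. Both
  sides of the adjoint equations therefore scale by \<open>k\<close>, and positivity of
  \<open>k\<close> preserves the minimizers and the nonvanishing of the primer vector.\<close>

lemma costates_for_max_mass_scale:
  assumes "k > 0"
    and co: "costates_for (max_mass_hamiltonian c1 c2 f B) B t0 tf x m u i lam lamm"
  shows "costates_for (max_mass_hamiltonian c1 c2 f B) B t0 tf x m u i
    (\<lambda>t. k *\<^sub>R lam t) (\<lambda>t. k * lamm t)"
  unfolding costates_for_def
proof (intro conjI)
  show "absolutely_continuous_on (\<lambda>t. k *\<^sub>R lam t) {t0..tf}"
    "absolutely_continuous_on (\<lambda>t. k * lamm t) {t0..tf}"
    using co absolutely_continuous_on_scaleR[of lam "{t0..tf}" k]
      absolutely_continuous_on_scaleR[of lamm "{t0..tf}" k] by (auto simp: costates_for_def)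
  let ?H = "max_mass_hamiltonian c1 c2 f B"
  have "adjoint_equations ?H t0 tf x m u i lam lamm"
    using co by (simp add: costates_for_def)
  then show "adjoint_equations ?H t0 tf x m u i (\<lambda>t. k *\<^sub>R lam t) (\<lambda>t. k * lamm t)"
    unfolding adjoint_equations_def max_mass_hamiltonian_scale
  proof eventually_elim
    case (elim t)
    then obtain Hx Hm where
      Hx: "GDERIV (\<lambda>y. ?H y (m t) (lam t) (lamm t) (u t) (i t)) (x t) :> Hx"
        "(lam has_vector_derivative - Hx) (at t within {t0..tf})"
      and Hm: "((\<lambda>\<mu>. ?H (x t) \<mu> (lam t) (lamm t) (u t) (i t)) has_real_derivative Hm) (at (m t))"
        "(lamm has_real_derivative - Hm) (at t within {t0..tf})"
      by blast
    have "GDERIV (\<lambda>y. k * ?H y (m t) (lam t) (lamm t) (u t) (i t)) (x t) :> k *\<^sub>R Hx"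
      using has_derivative_mult_right[OF Hx(1)[unfolded gderiv_def], of k] by (simp add: gderiv_def)
    moreover have "((\<lambda>t. k *\<^sub>R lam t) has_vector_derivative - (k *\<^sub>R Hx)) (at t within {t0..tf})"
      using bounded_linear.has_vector_derivative[OF bounded_linear_scaleR_right Hx(2), of k] by simp
    moreover have "((\<lambda>t. k * lamm t) has_real_derivative - (k * Hm)) (at t within {t0..tf})"
      using DERIV_cmult[OF Hm(2), of k] by simp
    ultimately show ?case
      using DERIV_cmult[OF Hm(1), of k] by blast
  qed
  show "minimum_condition ?H t0 tf x m u i (\<lambda>t. k *\<^sub>R lam t) (\<lambda>t. k * lamm t)"
    using co \<open>k > 0\<close> by (simp add: costates_for_def minimum_condition_def is_arg_min_def
        max_mass_hamiltonian_scale case_prod_beta)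
  show "nondegenerate B t0 tf x (\<lambda>t. k *\<^sub>R lam t)"
    using co \<open>k > 0\<close> by (simp add: costates_for_def nondegenerate_def matrix_vector_mult_scaleR)
qed

section \<open>Primer vector, switching function and the minimum condition\<close>

lemma max_mass_hamiltonian_primer:
  "max_mass_hamiltonian c1 c2 f B x m lam lamm u i =
     lam \<bullet> f x + c1 * u * (((transpose (B x) *v lam) \<bullet> i) / m - lamm / c2)"
proof -
  have "lam \<bullet> (B x *v i) = (transpose (B x) *v lam) \<bullet> i"
    by (simp add: dot_lmul_matrix)
  then show ?thesis
    by (simp add: max_mass_hamiltonian_def inner_add_right right_diff_distrib)
qed

text \<open>The drift term and the positive factor \<open>c1\<close> cancel from the comparison of
  Hamiltonians, leaving throttle times the switching function, the bracket that multiplies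
  \<open>c1 * u\<close>.\<close>

lemma max_mass_arg_minD:
  assumes "c1 > 0"
    and min: "is_arg_min (\<lambda>(v, w). max_mass_hamiltonian c1 c2 f B x m lam lamm v w)
        (\<lambda>(v, w). admissible_control v w) (u, i)"
  shows "0 \<le> u" "u \<le> 1" "norm i = 1"
    and "admissible_control v w \<Longrightarrow>
      u * (((transpose (B x) *v lam) \<bullet> i) / m - lamm / c2) \<le>
      v * (((transpose (B x) *v lam) \<bullet> w) / m - lamm / c2)"
proof -
  show "0 \<le> u" "u \<le> 1" "norm i = 1"
    using min by (auto simp: is_arg_min_linorder admissible_control_def)
  assume "admissible_control v w"
  with min have "max_mass_hamiltonian c1 c2 f B x m lam lamm u i \<le>
      max_mass_hamiltonian c1 c2 f B x m lam lamm v w"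
    unfolding is_arg_min_linorder by auto
  with \<open>c1 > 0\<close> show "u * (((transpose (B x) *v lam) \<bullet> i) / m - lamm / c2) \<le>
      v * (((transpose (B x) *v lam) \<bullet> w) / m - lamm / c2)"
    unfolding max_mass_hamiltonian_primer by (simp add: mult.assoc)
qed

lemma inner_opposite_direction:
  fixes p :: "'a::real_inner"
  assumes "p \<noteq> 0"
  shows "norm (- (p /\<^sub>R norm p)) = 1" "p \<bullet> (- (p /\<^sub>R norm p)) = - norm p"
  using assms by (auto simp: power2_norm_eq_inner[symmetric] power2_eq_square)

text \<open>Minimality against the direction opposite to \<open>p\<close> gives one inequality,
  Cauchy-Schwarz the other. The factor \<open>u\<close> stays in the conclusion because at zero
  throttle the direction is arbitrary.\<close>

lemma arg_min_direction:
  assumes "c1 > 0" "m > 0" and p: "p = transpose (B x) *v lam" "p \<noteq> 0"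
    and min: "is_arg_min (\<lambda>(v, w). max_mass_hamiltonian c1 c2 f B x m lam lamm v w)
        (\<lambda>(v, w). admissible_control v w) (u, i)"
  shows "u * (p \<bullet> i) = - u * norm p"
proof -
  note u = max_mass_arg_minD(1-3)[OF \<open>c1 > 0\<close> min]
  define j where "j = - (p /\<^sub>R norm p)"
  have j: "norm j = 1" "p \<bullet> j = - norm p"
    unfolding j_def by (fact inner_opposite_direction[OF p(2)])+
  \<comment> \<open>Comparing at the same throttle \<open>u\<close> makes the \<open>lamm\<close>
    terms cancel.\<close>
  have "u * ((p \<bullet> i) / m - lamm / c2) \<le> u * ((p \<bullet> j) / m - lamm / c2)"
    using max_mass_arg_minD(4)[OF \<open>c1 > 0\<close> min, of u j] u j p(1) by (simp add: admissible_control_def)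
  then have "u * (p \<bullet> i) / m \<le> u * (p \<bullet> j) / m"
    by (simp add: right_diff_distrib)
  then have "u * (p \<bullet> i) \<le> u * (p \<bullet> j)"
    using \<open>m > 0\<close> by (simp add: divide_le_cancel)
  moreover have "- norm p \<le> p \<bullet> i"
    using Cauchy_Schwarz_ineq2[of p i] u by simp
  then have "u * (- norm p) \<le> u * (p \<bullet> i)"
    using u by (intro mult_left_mono) auto
  ultimately show ?thesis
    using j by simp
qed

text \<open>In the optimal direction the switching function is negative when \<open>lamm\<close> is
  nonnegative, so raising the throttle to 1 would strictly lower the Hamiltonian.\<close>

lemma arg_min_full_throttle:
  assumes "c1 > 0" "c2 > 0" "m > 0" "lamm \<ge> 0" and p: "p = transpose (B x) *v lam" "p \<noteq> 0"
    and min: "is_arg_min (\<lambda>(v, w). max_mass_hamiltonian c1 c2 f B x m lam lamm v w)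
        (\<lambda>(v, w). admissible_control v w) (u, i)"
  shows "u = 1"
proof (rule ccontr)
  assume "u \<noteq> 1"
  note u = max_mass_arg_minD(1-3)[OF \<open>c1 > 0\<close> min]
  define j where "j = - (p /\<^sub>R norm p)"
  \<comment> \<open>This is the switching function in the direction \<open>j\<close>; by the
    direction law the given control also attains the value \<open>u * s\<close>.\<close>
  define s where "s = - norm p / m - lamm / c2"
  have j: "norm j = 1" "p \<bullet> j = - norm p"
    unfolding j_def by (fact inner_opposite_direction[OF p(2)])+
  have "u * s = u * (p \<bullet> i) / m - u * lamm / c2"
    by (simp add: s_def arg_min_direction[OF \<open>c1 > 0\<close> \<open>m > 0\<close> p min] right_diff_distrib)
  also have "\<dots> = u * ((p \<bullet> i) / m - lamm / c2)"
    by (simp add: right_diff_distrib)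
  also have "\<dots> \<le> 1 * ((p \<bullet> j) / m - lamm / c2)"
    using max_mass_arg_minD(4)[OF \<open>c1 > 0\<close> min, of 1 j] j p(1) by (simp add: admissible_control_def)
  finally have "0 \<le> (1 - u) * s"
    by (simp add: j s_def left_diff_distrib)
  moreover have "norm p / m > 0" "lamm / c2 \<ge> 0"
    using assms by auto
  then have "s < 0"
    by (simp add: s_def)
  moreover have "1 - u > 0"
    using u \<open>u \<noteq> 1\<close> by simp
  ultimately show False
    by (simp add: zero_le_mult_iff)
qed

section \<open>Positivity of the initial mass costate\<close>

lemma max_mass_hamiltonian_mass_derivative:
  assumes "m \<noteq> 0"
  shows "((\<lambda>\<mu>. max_mass_hamiltonian c1 c2 f B x \<mu> lam lamm u i) has_real_derivative
     - (c1 * (u * ((transpose (B x) *v lam) \<bullet> i)) / m\<^sup>2)) (at m)"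
  unfolding max_mass_hamiltonian_primer
  using assms by (auto intro!: derivative_eq_intros simp: power2_eq_square)

lemma mass_costate_pos:
  assumes "c1 > 0" "c2 > 0" "t0 < tf"
    and m: "\<And>t. t \<in> {t0..tf} \<Longrightarrow> m t > 0"
    and co: "costates_for (max_mass_hamiltonian c1 c2 f B) B t0 tf x m u i lam lamm"
    and "lamm tf = 0"
  shows "lamm t0 > 0"
proof -
  let ?H = "max_mass_hamiltonian c1 c2 f B"
  let ?p = "\<lambda>t. transpose (B (x t)) *v lam t"
  have ac: "absolutely_continuous_on lamm {t0..tf}"
    using co by (simp add: costates_for_def)
  \<comment> \<open>Stated as an almost-everywhere fact, membership is available when the pointwise
    conditions are combined.\<close>
  have in_Icc: "AE t in lebesgue_on {t0..tf}. t \<in> {t0..tf}"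
    by (rule AE_I2) simp
  have min: "AE t in lebesgue_on {t0..tf}. ?p t \<noteq> 0 \<and>
      is_arg_min (\<lambda>(v, w). ?H (x t) (m t) (lam t) (lamm t) v w)
          (\<lambda>(v, w). admissible_control v w) (u t, i t)"
    using co by (simp add: costates_for_def nondegenerate_def minimum_condition_def)
  have "AE t in lebesgue_on {t0..tf}. \<exists>Hm.
        ((\<lambda>\<mu>. ?H (x t) \<mu> (lam t) (lamm t) (u t) (i t)) has_real_derivative Hm) (at (m t)) \<and>
        (lamm has_real_derivative - Hm) (at t within {t0..tf})"
    using co unfolding costates_for_def adjoint_equations_def by (auto elim!: eventually_mono)
  with in_Icc min have der: "AE t in lebesgue_on {t0..tf}.
      (lamm has_real_derivative - (c1 * (u t * norm (?p t)) / (m t)\<^sup>2)) (at t within {t0..tf})"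
  proof eventually_elim
    case (elim t)
    then obtain Hm where
      Hm: "((\<lambda>\<mu>. ?H (x t) \<mu> (lam t) (lamm t) (u t) (i t)) has_real_derivative Hm) (at (m t))"
        "(lamm has_real_derivative - Hm) (at t within {t0..tf})"
      by blast
    have mt: "m t > 0" using m elim by blast
    \<comment> \<open>Uniqueness of the derivative identifies the \<open>Hm\<close> of the adjoint
      equation with the explicit formula; the direction law then fixes its sign.\<close>
    have "Hm = - (c1 * (u t * (?p t \<bullet> i t)) / (m t)\<^sup>2)"
      using DERIV_unique[OF Hm(1) max_mass_hamiltonian_mass_derivative] mt by simp
    also have "u t * (?p t \<bullet> i t) = - u t * norm (?p t)"
      using arg_min_direction[OF \<open>c1 > 0\<close> mt refl] elim by blast
    finally show ?case
      using Hm(2) by simp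
  qed
  have u: "AE t in lebesgue_on {t0..tf}. u t \<ge> 0"
    using min by eventually_elim (auto simp: is_arg_min_def admissible_control_def)
  \<comment> \<open>Only \<open>u t >= 0\<close> may be used here: full throttle presupposes
    \<open>lamm t >= 0\<close>, which is what this step delivers.\<close>
  have "antimono_on {t0..tf} lamm"
  proof (rule absolutely_continuous_on_antimono_on[OF ac])
    show "AE t in lebesgue_on {t0..tf}. \<exists>D\<le>0. (lamm has_real_derivative D) (at t within {t0..tf})"
      using der u
    proof eventually_elim
      case (elim t)
      have "- (c1 * (u t * norm (?p t)) / (m t)\<^sup>2) \<le> 0"
        using elim \<open>c1 > 0\<close> by simp
      with elim show ?case by blast
    qed
  qed
  then have nonneg: "lamm t \<ge> 0" if "t \<in> {t0..tf}" for t
    using that \<open>lamm tf = 0\<close> by (force dest!: monotone_onD[of _ _ _ _ t tf])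
  have "lamm tf < lamm t0"
  proof (rule absolutely_continuous_on_decreasing[OF \<open>t0 < tf\<close> ac])
    show "AE t in lebesgue_on {t0..tf}. \<exists>D<0. (lamm has_real_derivative D) (at t within {t0..tf})"
      using in_Icc min der
    proof eventually_elim
      case (elim t)
      have mt: "m t > 0" "lamm t \<ge> 0" using m nonneg elim by auto
      have "u t = 1"
        using arg_min_full_throttle[OF \<open>c1 > 0\<close> \<open>c2 > 0\<close> mt refl] elim by blast
      then have "- (c1 * (u t * norm (?p t)) / (m t)\<^sup>2) < 0"
        using elim \<open>c1 > 0\<close> mt by simp
      with elim show ?case by blast
    qed
  qed
  with \<open>lamm tf = 0\<close> show ?thesis by simp
qed

theorem theorem1:
  fixes c1 c2 t0 :: real
    and X :: "(real^6) set"
    and f :: "real^6 \<Rightarrow> real^6"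
    and B :: "real^6 \<Rightarrow> real^3^6"
    and x0 xf :: "real^6"
  assumes "c1 > 0" and "c2 > 0"
    and "open X"
    and "continuously_differentiable_on f X"
    and "continuously_differentiable_on B X"
  shows "(\<forall>m0 x m u i tf. m0 > 0 \<longrightarrow>
            min_time_extremal c1 c2 X f B t0 x0 m0 xf x m u i tf \<longrightarrow>
            max_initial_mass_extremal c1 c2 X f B t0 tf x0 xf x m u i) \<and>
         (\<forall>x m u i tf. tf > t0 \<longrightarrow>
            max_initial_mass_extremal c1 c2 X f B t0 tf x0 xf x m u i \<longrightarrow>
            min_time_extremal c1 c2 X f B t0 x0 (m t0) xf x m u i tf)"
proof (intro conjI allI impI)
  fix m0 x m u i tf
  assume "min_time_extremal c1 c2 X f B t0 x0 m0 xf x m u i tf"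
  then obtain lam lamm where tf: "t0 < tf" "x t0 = x0" "x tf = xf" "lamm tf = 0"
    and adm: "admissible_trajectory c1 c2 X f B t0 tf x m u i"
    and co: "costates_for (max_mass_hamiltonian c1 c2 f B) B t0 tf x m u i lam lamm"
    unfolding min_time_extremal_def costates_for_min_time_iff by blast
  have pos: "lamm t0 > 0"
    using adm by (intro mass_costate_pos[OF assms(1,2) tf(1) _ co tf(4)])
      (simp add: admissible_trajectory_def)
  \<comment> \<open>This factor normalises the initial mass costate to 1; the terminal value 0 is
    unaffected by scaling.\<close>
  define k where "k = inverse (lamm t0)"
  have "k > 0" "k * lamm t0 = 1"
    using pos by (simp_all add: k_def)
  with costates_for_max_mass_scale[OF _ co] tf adm
  show "max_initial_mass_extremal c1 c2 X f B t0 tf x0 xf x m u i"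
    unfolding max_initial_mass_extremal_def
    by (intro conjI exI[of _ "\<lambda>t. k *\<^sub>R lam t"] exI[of _ "\<lambda>t. k * lamm t"]) auto
next
  fix x m u i tf
  assume "max_initial_mass_extremal c1 c2 X f B t0 tf x0 xf x m u i"
  \<comment> \<open>The same costates serve: the condition \<open>lamm t0 = 1\<close> is dropped and
    the prescribed initial mass is the attained one.\<close>
  then show "min_time_extremal c1 c2 X f B t0 x0 (m t0) xf x m u i tf"
    unfolding max_initial_mass_extremal_def min_time_extremal_def costates_for_min_time_iff by blast
qed

end
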